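(* Let $r\ge 1$ be an integer. If $d=2^r$, then $\gamma_{d-1}^{\mathrm L}(Q_d)=2^{\,2^r-r}$, and if $d=2^r+1$, then $\gamma_{d-1}^{\mathrm L}(Q_d)=2^{\,2^r-r+1}$.
   Context: All graphs are finite and simple; $N_G(u)$ is the open neighborhood of $u$ in $G$. A set $D\subseteq V(G)$ is a dominating set if every vertex of $V(G)\setminus D$ has a neighbor in $D$. For an integer $k\ge 0$, a dominating set $D$ of $G$ is a $k$-limited dominating set if $|N_G(u)\setminus D|\le k$ for every $u\in D$, and $\gamma_k^{\mathrm L}(G)$ is the minimum cardinality of a $k$-limited dominating set of $G$. The hypercube $Q_d$ has vertex set $\{0,1\}^d$, two vertices being adjacent if and only if they differ in exactly one coordinate. *)

theory Defs
  imports Complex_Main "HOL-Library.FuncSet"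
begin

type_synonym 'a graph = "'a set \<times> 'a set set"

abbreviation verts :: "'a graph \<Rightarrow> 'a set" where
  "verts G \<equiv> fst G"

abbreviation edges :: "'a graph \<Rightarrow> 'a set set" where
  "edges G \<equiv> snd G"

definition finite_simple_graph :: "'a graph \<Rightarrow> bool" where
  "finite_simple_graph G \<longleftrightarrow>
     finite (verts G) \<and> (\<forall>e\<in>edges G. e \<subseteq> verts G \<and> card e = 2)"

definition nbhd :: "'a graph \<Rightarrow> 'a \<Rightarrow> 'a set" where
  "nbhd G u = {v \<in> verts G. {u, v} \<in> edges G}"

definition dominating :: "'a graph \<Rightarrow> 'a set \<Rightarrow> bool" where
  "dominating G D \<longleftrightarrow>
     D \<subseteq> verts G \<and> (\<forall>v \<in> verts G - D. nbhd G v \<inter> D \<noteq> {})"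

definition limited_dominating :: "nat \<Rightarrow> 'a graph \<Rightarrow> 'a set \<Rightarrow> bool" where
  "limited_dominating k G D \<longleftrightarrow>
     dominating G D \<and> (\<forall>u\<in>D. card (nbhd G u - D) \<le> k)"

text \<open>For a finite graph the minimum below is taken over a finite nonempty set, see the
  lemmas \<open>limited_dominating_verts\<close> and \<open>finite_limited_dominating\<close>.\<close>

definition limited_domination_number :: "nat \<Rightarrow> 'a graph \<Rightarrow> nat" where
  "limited_domination_number k G = Min (card ` {D. limited_dominating k G D})"

lemma limited_dominating_verts: "limited_dominating k G (verts G)"
proof -
  have "card (nbhd G u - verts G) = 0" for u
  proof -
    have "nbhd G u - verts G = {}" by (auto simp: nbhd_def)
    then show ?thesis by (simp only: card.empty)
  qed
  then show ?thesis by (simp add: limited_dominating_def dominating_def)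
qed

lemma finite_limited_dominating:
  assumes "finite_simple_graph G"
  shows "finite {D. limited_dominating k G D}"
proof (rule finite_subset)
  show "{D. limited_dominating k G D} \<subseteq> Pow (verts G)"
    by (auto simp: limited_dominating_def dominating_def)
  show "finite (Pow (verts G))"
    using assms by (simp add: finite_simple_graph_def)
qed

text \<open>Binary words of length \<open>d\<close> are functions on \<open>{..<d}\<close>, extended by \<open>undefined\<close>
  outside (so that distinct functions are distinct words).\<close>

definition cube_verts :: "nat \<Rightarrow> (nat \<Rightarrow> nat) set" where
  "cube_verts d = {..<d} \<rightarrow>\<^sub>E {0, 1}"

definition hypercube :: "nat \<Rightarrow> (nat \<Rightarrow> nat) graph" where
  "hypercube d =
     (cube_verts d,
      {{x, y} | x y. x \<in> cube_verts d \<and> y \<in> cube_verts d \<and> (\<exists>!i. i < d \<and> x i \<noteq> y i)})"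

lemma finite_simple_graph_hypercube: "finite_simple_graph (hypercube d)"
proof -
  have "finite (cube_verts d)"
    by (simp add: cube_verts_def finite_PiE)
  moreover have "card {x, y} = 2" if "\<exists>!i. i < d \<and> x i \<noteq> y i" for x y :: "nat \<Rightarrow> nat"
  proof -
    have "x \<noteq> y" using that by blast
    then show ?thesis by simp
  qed
  ultimately show ?thesis
    by (auto simp: finite_simple_graph_def hypercube_def)
qed

end

theory Submission imports Defs
begin

text \<open>A dominating set of $Q_d$ is $(d-1)$-limited iff every vertex has a neighbour in it.

  Upper bound: let the syndrome of a word be the bitwise exclusive or of the positions \<open>i < 2 ^ r\<close> at
  which it is 1. Flipping position \<open>i\<close> adds \<open>i\<close> to the syndrome, so from every word exactly one
  flip at a position below \<open>2 ^ r\<close> leads to syndrome 0. The words of syndrome 0 are thus totally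
  dominating, and there are \<open>2 ^ (d - r)\<close> of them.

  Lower bound: if \<open>d = 2 ^ r\<close>, every vertex dominates only \<open>d\<close> vertices. If \<open>d = 2 ^ r + 1\<close>,
  this count is refined by van Wee's excess argument. Let \<open>f x\<close> be the number of neighbours of \<open>x\<close>
  in \<open>D\<close> and \<open>E = f - 1\<close>. For \<open>z \<notin> D\<close> the sum of \<open>f\<close> over the neighbours of
  \<open>z\<close> is even, since every vertex at distance 2 is counted twice. As \<open>d\<close> is odd, the sum of \<open>E\<close>
  over these neighbours is odd, hence positive. Conversely, a vertex with \<open>E x > 0\<close> has at most
  \<open>d - 2\<close> neighbours outside \<open>D\<close>. Counting pairs gives
  \<open>2 ^ d - |D| \<le> (d - 2) * (d * |D| - 2 ^ d)\<close>, that is, \<open>2 ^ d \<le> (d - 1) * |D|\<close>.\<close>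

section \<open>Neighbourhoods in the hypercube\<close>

text \<open>Truncated subtraction swaps 0 and 1 and sends every larger number to 0, so
  \<open>flip i\<close> undoes itself only where the entry is a bit.\<close>

definition flip :: "nat \<Rightarrow> (nat \<Rightarrow> nat) \<Rightarrow> nat \<Rightarrow> nat" where
  "flip i x = x(i := 1 - x i)"

lemma cube_verts_le_1: "x \<in> cube_verts d \<Longrightarrow> i < d \<Longrightarrow> x i \<le> 1"
  by (fastforce simp: cube_verts_def PiE_def Pi_def)

lemma flip_in_cube_verts: "x \<in> cube_verts d \<Longrightarrow> i < d \<Longrightarrow> flip i x \<in> cube_verts d"
  by (fastforce simp: cube_verts_def PiE_def Pi_def flip_def extensional_def)

lemma flip_flip: "x \<in> cube_verts d \<Longrightarrow> i < d \<Longrightarrow> flip i (flip i x) = x"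
  using cube_verts_le_1[of x d i] by (auto simp: flip_def)

lemma flip_commute: "flip i (flip j x) = flip j (flip i x)"
  by (auto simp: flip_def fun_eq_iff)

lemma inj_on_flip_index:
  assumes "x \<in> cube_verts d"
  shows "inj_on (\<lambda>i. flip i x) {..<d}"
proof (rule inj_onI)
  fix i j assume ij: "i \<in> {..<d}" "j \<in> {..<d}" "flip i x = flip j x"
  show "i = j"
  proof (rule ccontr)
    assume "i \<noteq> j"
    then have "1 - x i = x i"
      using fun_cong[OF ij(3), of i] by (simp add: flip_def)
    then show False by presburger
  qed
qed

lemma bij_betw_flip: "i < d \<Longrightarrow> bij_betw (flip i) (cube_verts d) (cube_verts d)"
  by (rule bij_betwI[where g = "flip i"]) (auto simp: flip_flip flip_in_cube_verts)

lemma finite_cube_verts: "finite (cube_verts d)"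
  by (simp add: cube_verts_def finite_PiE)

lemma card_cube_verts: "card (cube_verts d) = 2 ^ d"
  by (simp add: cube_verts_def card_PiE numeral_2_eq_2)

lemma unique_difference_iff_flip:
  assumes "x \<in> cube_verts d" "y \<in> cube_verts d"
  shows "(\<exists>!i. i < d \<and> x i \<noteq> y i) \<longleftrightarrow> (\<exists>i<d. y = flip i x)"
proof
  assume "\<exists>!i. i < d \<and> x i \<noteq> y i"
  then obtain i where i: "i < d" "x i \<noteq> y i" "\<And>j. j < d \<Longrightarrow> j \<noteq> i \<Longrightarrow> x j = y j"
    by blast
  have "y j = flip i x j" for j
  proof (cases "j < d")
    case True
    then show ?thesis
      using i cube_verts_le_1[OF assms(1) i(1)] cube_verts_le_1[OF assms(2) i(1)]
      by (auto simp: flip_def)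
  next
    case False
    then show ?thesis
      using assms i(1) by (auto simp: flip_def cube_verts_def PiE_def extensional_def)
  qed
  then show "\<exists>i<d. y = flip i x" using i(1) by blast
next
  assume "\<exists>i<d. y = flip i x"
  then obtain i where i: "i < d" "y = flip i x" by blast
  have "x i \<noteq> 1 - x i" by presburger
  with i show "\<exists>!i. i < d \<and> x i \<noteq> y i"
    by (intro ex1I[of _ i]) (auto simp: flip_def split: if_splits)
qed

lemma nbhd_hypercube:
  assumes "x \<in> cube_verts d"
  shows "nbhd (hypercube d) x = (\<lambda>i. flip i x) ` {..<d}"
proof -
  \<comment> \<open>Naming the predicate hides the unique existence from automation; symmetry of
    \<open>P\<close> is all that the unordered edges require.\<close>
  define P where "P a b \<longleftrightarrow> (\<exists>!i. i < d \<and> a i \<noteq> b i)" for a b :: "nat \<Rightarrow> nat"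
  have sym: "P a b \<longleftrightarrow> P b a" for a b
    unfolding P_def by (simp only: eq_commute[of "a _" "b _"])
  have edges: "edges (hypercube d) = {{a, b} | a b. a \<in> cube_verts d \<and> b \<in> cube_verts d \<and> P a b}"
    by (simp add: hypercube_def P_def)
  have "v \<in> nbhd (hypercube d) x \<longleftrightarrow> v \<in> cube_verts d \<and> P x v" for v
    using assms sym[of x v] unfolding nbhd_def edges
    by (auto simp: hypercube_def doubleton_eq_iff)
  moreover have "P x v \<longleftrightarrow> (\<exists>i<d. v = flip i x)" if "v \<in> cube_verts d" for v
    unfolding P_def using assms that by (rule unique_difference_iff_flip)
  ultimately show ?thesis
    using flip_in_cube_verts[OF assms] by auto
qed

text \<open>Each vertex has exactly \<open>d\<close> neighbours, so at most \<open>d - 1\<close> of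
  them lie outside \<open>D\<close> iff some neighbour lies in \<open>D\<close>. The limit says this
  for vertices in \<open>D\<close>, domination for the others.\<close>

lemma limited_dominating_hypercube_iff:
  assumes "d > 0"
  shows "limited_dominating (d - 1) (hypercube d) D \<longleftrightarrow>
         D \<subseteq> cube_verts d \<and> (\<forall>x\<in>cube_verts d. \<exists>i<d. flip i x \<in> D)"
proof -
  have card_iff: "card (nbhd (hypercube d) x - D) \<le> d - 1 \<longleftrightarrow> nbhd (hypercube d) x \<inter> D \<noteq> {}"
    if "x \<in> cube_verts d" for x
  proof -
    let ?N = "nbhd (hypercube d) x"
    have fin: "finite ?N" and card: "card ?N = d"
      using that inj_on_flip_index[OF that] by (simp_all add: nbhd_hypercube card_image)
    show ?thesis
    proof
      assume "card (?N - D) \<le> d - 1"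
      then show "?N \<inter> D \<noteq> {}"
        using card assms by (auto simp: Diff_triv)
    next
      assume "?N \<inter> D \<noteq> {}"
      then have "?N - D \<subset> ?N" by blast
      then show "card (?N - D) \<le> d - 1"
        using psubset_card_mono[OF fin, of "?N - D"] card by linarith
    qed
  qed
  have nbr: "nbhd (hypercube d) x \<inter> D \<noteq> {} \<longleftrightarrow> (\<exists>i<d. flip i x \<in> D)"
    if "x \<in> cube_verts d" for x
    using that by (auto simp: nbhd_hypercube)
  have verts: "verts (hypercube d) = cube_verts d" by (simp add: hypercube_def)
  have "limited_dominating (d - 1) (hypercube d) D \<longleftrightarrow>
        D \<subseteq> cube_verts d \<and> (\<forall>x\<in>cube_verts d. nbhd (hypercube d) x \<inter> D \<noteq> {})"
    using card_iff unfolding limited_dominating_def dominating_def verts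
    by (meson Diff_iff subsetD)
  also have "\<dots> \<longleftrightarrow> D \<subseteq> cube_verts d \<and> (\<forall>x\<in>cube_verts d. \<exists>i<d. flip i x \<in> D)"
    using nbr by (simp cong: ball_cong)
  finally show ?thesis .
qed

section \<open>Words of syndrome zero\<close>

text \<open>Reading \<open>m\<close> in binary as a column of a parity-check matrix gives the
  Hamming code with an extra zero column. Position 0 is thus free, which provides words of syndrome
  zero with a neighbour of syndrome zero.\<close>

primrec syndrome :: "nat \<Rightarrow> (nat \<Rightarrow> nat) \<Rightarrow> nat" where
  "syndrome 0 x = 0"
| "syndrome (Suc m) x = xor (syndrome m x) (if x m = 1 then m else 0)"

lemma syndrome_cong: "(\<And>i. i < m \<Longrightarrow> x i = y i) \<Longrightarrow> syndrome m x = syndrome m y"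
  by (induction m) auto

lemma syndrome_flip:
  assumes "i < m" "x i \<le> 1"
  shows "syndrome m (flip i x) = xor (syndrome m x) i"
  using assms(1)
proof (induction m)
  case (Suc m)
  show ?case
  proof (cases "i = m")
    case True
    have "syndrome m (flip i x) = syndrome m x"
      by (rule syndrome_cong) (simp add: flip_def True)
    moreover have "flip i x m = 1 - x m" by (simp add: flip_def True)
    moreover have "x m = 0 \<or> x m = 1" using True assms(2) by auto
    ultimately show ?thesis
      using True by (auto simp: xor.assoc)
  next
    case False
    then show ?thesis
      using Suc by (simp add: flip_def ac_simps)
  qed
qed simp

text \<open>Numbers below \<open>2 ^ r\<close> are the fixed points of \<open>take_bit r\<close>,
  which commutes with \<open>xor\<close>.\<close>

lemma syndrome_less: "m \<le> 2 ^ r \<Longrightarrow> syndrome m x < 2 ^ r"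
proof (induction m)
  case (Suc m)
  have "take_bit r (syndrome m x) = syndrome m x" "take_bit r m = m"
    using Suc by (auto simp: take_bit_nat_eq_self)
  then have "take_bit r (syndrome (Suc m) x) = syndrome (Suc m) x"
    by (simp add: take_bit_xor)
  then show ?case by (metis take_bit_nat_less_exp)
qed simp

lemma xor_eq_0_iff: "xor a b = 0 \<longleftrightarrow> a = (b :: nat)"
  by (metis xor.assoc xor.left_neutral xor.right_neutral xor_self_eq)

lemma syndrome_flip_eq_0_iff:
  assumes "x \<in> cube_verts d" "2 ^ r \<le> d" "i < 2 ^ r"
  shows "syndrome (2 ^ r) (flip i x) = 0 \<longleftrightarrow> i = syndrome (2 ^ r) x"
  using assms cube_verts_le_1[of x d i] by (auto simp: syndrome_flip xor_eq_0_iff)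

lemma card_syndrome_0:
  assumes "2 ^ r \<le> d"
  shows "card {x \<in> cube_verts d. syndrome (2 ^ r) x = 0} = 2 ^ (d - r)"
proof -
  let ?s = "syndrome (2 ^ r)"
  let ?D = "{x \<in> cube_verts d. ?s x = 0}"
  have s: "?s x < 2 ^ r" for x by (rule syndrome_less) simp
  have s_d: "?s x < d" for x using s[of x] assms by linarith
  have "bij_betw (\<lambda>(i, x). flip i x) ({..<2 ^ r} \<times> ?D) (cube_verts d)"
  \<comment> \<open>The inverse is syndrome decoding: \<open>?s y\<close> is the one position below
    \<open>2 ^ r\<close> whose flip brings the syndrome to 0.\<close>
  proof (rule bij_betwI[where g = "\<lambda>y. (?s y, flip (?s y) y)"])
    show "(\<lambda>(i, x). flip i x) \<in> {..<2 ^ r} \<times> ?D \<rightarrow> cube_verts d"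
      using assms by (auto intro: flip_in_cube_verts)
    show "(\<lambda>y. (?s y, flip (?s y) y)) \<in> cube_verts d \<rightarrow> {..<2 ^ r} \<times> ?D"
      using assms s s_d by (auto simp: syndrome_flip_eq_0_iff flip_in_cube_verts)
    show "(\<lambda>y. (?s y, flip (?s y) y)) ((\<lambda>(i, x). flip i x) p) = p"
      if "p \<in> {..<2 ^ r} \<times> ?D" for p
    proof -
      obtain i x where p: "p = (i, x)" by (cases p)
      have i: "i < 2 ^ r" "i < d" and x: "x \<in> cube_verts d" "?s x = 0"
        using that assms p by auto
      have "?s (flip i x) = i"
        using syndrome_flip[of i "2 ^ r" x] cube_verts_le_1[OF x(1) i(2)] i(1) x(2) by simp
      then show ?thesis using p flip_flip[OF x(1) i(2)] by simp
    qed
    show "(\<lambda>(i, x). flip i x) ((\<lambda>y. (?s y, flip (?s y) y)) y) = y"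
      if "y \<in> cube_verts d" for y
      using that s_d by (simp add: flip_flip)
  qed
  from bij_betw_same_card[OF this] have "2 ^ r * card ?D = 2 ^ d"
    by (simp only: card_cartesian_product card_lessThan card_cube_verts)
  moreover have "r \<le> d"
    using assms less_exp[of r] by linarith
  then have "(2::nat) ^ d = 2 ^ r * 2 ^ (d - r)"
    by (simp flip: power_add)
  ultimately show ?thesis by simp
qed

lemma limited_dominating_syndrome_0:
  assumes "2 ^ r \<le> d"
  shows "limited_dominating (d - 1) (hypercube d) {x \<in> cube_verts d. syndrome (2 ^ r) x = 0}"
proof -
  have "0 < (2::nat) ^ r" by simp
  then have d: "d > 0" using assms by linarith
  have "\<exists>i<d. flip i x \<in> {x \<in> cube_verts d. syndrome (2 ^ r) x = 0}"
    if x: "x \<in> cube_verts d" for x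
  proof (intro exI conjI)
    have *: "syndrome (2 ^ r) x < 2 ^ r" by (rule syndrome_less) simp
    then show "syndrome (2 ^ r) x < d" using assms by linarith
    then show "flip (syndrome (2 ^ r) x) x \<in> {x \<in> cube_verts d. syndrome (2 ^ r) x = 0}"
      using x * assms by (simp add: flip_in_cube_verts syndrome_flip_eq_0_iff)
  qed
  then show ?thesis
    unfolding limited_dominating_hypercube_iff[OF d] by blast
qed

section \<open>Lower bounds on total domination\<close>

lemma sum_flip:
  assumes "i < d"
  shows "(\<Sum>x\<in>cube_verts d. F (flip i x)) = (\<Sum>x\<in>cube_verts d. F x)"
  using sum.reindex_bij_betw[OF bij_betw_flip[OF assms]] .

text \<open>Off-diagonal entries occur in equal pairs, and the added sum doubles the
  diagonal.\<close>

lemma even_symmetric_sum: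
  fixes h :: "nat \<Rightarrow> nat \<Rightarrow> int"
  assumes "\<And>i j. h i j = h j i"
  shows "even ((\<Sum>i<n. \<Sum>j<n. h i j) + (\<Sum>i<n. h i i))"
proof (induction n)
  case (Suc n)
  have "(\<Sum>i<Suc n. \<Sum>j<Suc n. h i j) + (\<Sum>i<Suc n. h i i) =
        ((\<Sum>i<n. \<Sum>j<n. h i j) + (\<Sum>i<n. h i i)) + 2 * ((\<Sum>i<n. h n i) + h n n)"
    using assms by (simp add: sum.distrib algebra_simps)
  with Suc show ?case by simp
qed simp

locale total_dominating_cube =
  fixes d :: nat and D :: "(nat \<Rightarrow> nat) set"
  assumes subset: "D \<subseteq> cube_verts d"
    and total: "x \<in> cube_verts d \<Longrightarrow> \<exists>i<d. flip i x \<in> D"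
begin

text \<open>Integer values keep the later differences free of truncation.\<close>

definition ind :: "(nat \<Rightarrow> nat) \<Rightarrow> int" where
  "ind x = of_bool (x \<in> D)"

definition nbr_count :: "(nat \<Rightarrow> nat) \<Rightarrow> int" where
  "nbr_count x = (\<Sum>i<d. ind (flip i x))"

lemma nbr_count_ge_1:
  assumes "x \<in> cube_verts d"
  shows "nbr_count x \<ge> 1"
proof -
  obtain i where i: "i < d" "flip i x \<in> D" using total[OF assms] by blast
  then have "1 = ind (flip i x)" by (simp add: ind_def)
  also have "\<dots> \<le> nbr_count x"
    unfolding nbr_count_def using i by (intro member_le_sum) (auto simp: ind_def)
  finally show ?thesis .
qed

lemma sum_ind: "(\<Sum>x\<in>cube_verts d. ind x) = int (card D)"
proof -
  have "cube_verts d \<inter> D = D" using subset by blast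
  then show ?thesis by (simp add: ind_def sum.If_cases finite_cube_verts of_bool_def Int_def)
qed

lemma sum_nbr_count: "(\<Sum>x\<in>cube_verts d. nbr_count x) = int d * int (card D)"
  unfolding nbr_count_def by (subst sum.swap) (simp add: sum_flip sum_ind)

lemma card_bound: "2 ^ d \<le> d * card D"
proof -
  have "(\<Sum>x\<in>cube_verts d. 1) \<le> (\<Sum>x\<in>cube_verts d. nbr_count x)"
    by (intro sum_mono nbr_count_ge_1)
  then have "int (2 ^ d) \<le> int (d * card D)"
    by (simp add: sum_nbr_count card_cube_verts)
  then show ?thesis by (simp only: of_nat_le_iff)
qed

text \<open>The matrix with entries \<open>ind (flip j (flip i z))\<close> is symmetric as flips
  commute, and its diagonal entries are \<open>ind z = 0\<close>.\<close>

lemma even_sum_nbr_count: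
  assumes "z \<in> cube_verts d" "z \<notin> D"
  shows "even (\<Sum>i<d. nbr_count (flip i z))"
proof -
  have "(\<Sum>i<d. ind (flip i (flip i z))) = 0"
    using assms by (simp add: flip_flip ind_def)
  then show ?thesis
    using even_symmetric_sum[of "\<lambda>i j. ind (flip j (flip i z))" d]
    by (simp add: nbr_count_def flip_commute)
qed

lemma excess_ge_1:
  assumes "odd d" "z \<in> cube_verts d" "z \<notin> D"
  shows "(\<Sum>i<d. nbr_count (flip i z) - 1) \<ge> 1"
proof -
  have "odd (\<Sum>i<d. nbr_count (flip i z) - 1)"
    using even_sum_nbr_count[OF assms(2,3)] assms(1) by (simp add: sum_subtractf)
  moreover have "(\<Sum>i<d. nbr_count (flip i z) - 1) \<ge> 0"
    using nbr_count_ge_1[OF flip_in_cube_verts[OF assms(2)]]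
    by (intro sum_nonneg) fastforce
  ultimately show ?thesis by presburger
qed

text \<open>Double counting of adjacent pairs \<open>z\<close>, \<open>x\<close> with
  \<open>z\<close> outside \<open>D\<close>, weighted by the excess of \<open>x\<close>: exactly
  \<open>int d - nbr_count x\<close> neighbours of \<open>x\<close> lie outside
  \<open>D\<close>.\<close>

lemma sum_excess_outside:
  "(\<Sum>z\<in>cube_verts d. (1 - ind z) * (\<Sum>i<d. nbr_count (flip i z) - 1)) =
   (\<Sum>x\<in>cube_verts d. (nbr_count x - 1) * (int d - nbr_count x))"
proof -
  have "(\<Sum>z\<in>cube_verts d. (1 - ind z) * (\<Sum>i<d. nbr_count (flip i z) - 1)) =
        (\<Sum>i<d. \<Sum>z\<in>cube_verts d. (1 - ind z) * (nbr_count (flip i z) - 1))"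
    unfolding sum_distrib_left by (rule sum.swap)
  also have "\<dots> = (\<Sum>i<d. \<Sum>x\<in>cube_verts d. (1 - ind (flip i x)) * (nbr_count x - 1))"
  proof (rule sum.cong[OF refl])
    fix i assume "i \<in> {..<d}"
    then have i: "i < d" by simp
    \<comment> \<open>Substitution \<open>z = flip i x\<close>, with \<open>x\<close> first written
      as \<open>flip i z\<close>.\<close>
    have "(\<Sum>x\<in>cube_verts d. (1 - ind (flip i x)) * (nbr_count x - 1)) =
          (\<Sum>x\<in>cube_verts d. (1 - ind (flip i x)) * (nbr_count (flip i (flip i x)) - 1))"
      by (intro sum.cong refl) (simp add: flip_flip[OF _ i])
    also have "\<dots> = (\<Sum>z\<in>cube_verts d. (1 - ind z) * (nbr_count (flip i z) - 1))"
      by (rule sum_flip[OF i, of "\<lambda>z. (1 - ind z) * (nbr_count (flip i z) - 1)"])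
    finally show "(\<Sum>z\<in>cube_verts d. (1 - ind z) * (nbr_count (flip i z) - 1)) =
      (\<Sum>x\<in>cube_verts d. (1 - ind (flip i x)) * (nbr_count x - 1))" by simp
  qed
  also have "\<dots> = (\<Sum>x\<in>cube_verts d. \<Sum>i<d. (1 - ind (flip i x)) * (nbr_count x - 1))"
    by (rule sum.swap)
  also have "\<dots> = (\<Sum>x\<in>cube_verts d. (nbr_count x - 1) * (int d - nbr_count x))"
    unfolding sum_distrib_right[symmetric]
    by (simp add: sum_subtractf nbr_count_def[symmetric] mult.commute)
  finally show ?thesis .
qed

lemma card_bound_odd:
  assumes "odd d" "d \<ge> 2"
  shows "2 ^ d \<le> (d - 1) * card D"
proof -
  let ?V = "cube_verts d"
  have "2 ^ d - int (card D) = (\<Sum>z\<in>?V. 1 - ind z)"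
    by (simp add: sum_subtractf sum_ind card_cube_verts)
  also have "\<dots> \<le> (\<Sum>z\<in>?V. (1 - ind z) * (\<Sum>i<d. nbr_count (flip i z) - 1))"
    using excess_ge_1[OF assms(1)] by (intro sum_mono) (simp add: ind_def)
  also have "\<dots> = (\<Sum>x\<in>?V. (nbr_count x - 1) * (int d - nbr_count x))"
    by (rule sum_excess_outside)
  also have "\<dots> \<le> (\<Sum>x\<in>?V. (nbr_count x - 1) * (int d - 2))"
  proof (rule sum_mono)
    fix x assume "x \<in> ?V"
    then have "nbr_count x \<ge> 1" by (rule nbr_count_ge_1)
    \<comment> \<open>Both sides vanish at count 1; otherwise two neighbours in \<open>D\<close>
      leave at most \<open>d - 2\<close> outside.\<close>
    then consider "nbr_count x = 1" | "nbr_count x \<ge> 2" by linarith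
    then show "(nbr_count x - 1) * (int d - nbr_count x) \<le> (nbr_count x - 1) * (int d - 2)"
      by cases (auto intro: mult_left_mono)
  qed
  also have "\<dots> = (int d * int (card D) - 2 ^ d) * (int d - 2)"
    by (simp add: sum_distrib_right[symmetric] sum_subtractf sum_nbr_count card_cube_verts)
  \<comment> \<open>The coefficient of \<open>card D\<close> becomes \<open>d * (d - 2) + 1\<close>,
    the square of \<open>d - 1\<close>, so one positive factor \<open>d - 1\<close> cancels.\<close>
  finally have "(int d - 1) * 2 ^ d \<le> (int d - 1) * ((int d - 1) * int (card D))"
    by (simp add: algebra_simps)
  then have "2 ^ d \<le> (int d - 1) * int (card D)"
    using assms(2) by (simp only: mult_le_cancel_left_pos)
  then have "int (2 ^ d) \<le> int ((d - 1) * card D)"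
    using assms(2) by (simp add: of_nat_diff)
  then show ?thesis by (simp only: of_nat_le_iff)
qed

end

section \<open>Exact values of the limited domination number\<close>

text \<open>The construction serves both cases; only the source of \<open>bound\<close> differs, as
  \<open>2 ^ r\<close> is \<open>d\<close> in one and \<open>d - 1\<close> in the other.\<close>

lemma limited_domination_number_hypercube:
  assumes le: "2 ^ r \<le> d"
    and bound: "\<And>D. total_dominating_cube d D \<Longrightarrow> 2 ^ d \<le> 2 ^ r * card D"
  shows "limited_domination_number (d - 1) (hypercube d) = 2 ^ (d - r)"
  unfolding limited_domination_number_def
proof (rule Min_eqI)
  show "finite (card ` {D. limited_dominating (d - 1) (hypercube d) D})"
    by (rule finite_imageI[OF finite_limited_dominating[OF finite_simple_graph_hypercube]])
  show "2 ^ (d - r) \<in> card ` {D. limited_dominating (d - 1) (hypercube d) D}"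
    unfolding card_syndrome_0[OF le, symmetric]
    by (rule imageI) (rule CollectI, rule limited_dominating_syndrome_0[OF le])
  have "0 < (2::nat) ^ r" by simp
  then have d: "d > 0" using le by linarith
  have "r \<le> d" using le less_exp[of r] by linarith
  then have pow: "(2::nat) ^ d = 2 ^ r * 2 ^ (d - r)" by (simp flip: power_add)
  fix n assume "n \<in> card ` {D. limited_dominating (d - 1) (hypercube d) D}"
  then obtain D where n: "n = card D" and D: "limited_dominating (d - 1) (hypercube d) D"
    by blast
  have "total_dominating_cube d D"
    using D unfolding limited_dominating_hypercube_iff[OF d] total_dominating_cube_def by blast
  from bound[OF this] show "2 ^ (d - r) \<le> n" by (simp add: n pow)
qed

theorem corollary20:
  fixes r d :: nat
  assumes "r \<ge> 1"
  shows "(d = 2 ^ r \<longrightarrow>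
            limited_domination_number (d - 1) (hypercube d) = 2 ^ (2 ^ r - r)) \<and>
         (d = 2 ^ r + 1 \<longrightarrow>
            limited_domination_number (d - 1) (hypercube d) = 2 ^ (2 ^ r - r + 1))"
proof (intro conjI impI)
  assume d: "d = 2 ^ r"
  then have "2 ^ d \<le> 2 ^ r * card D" if "total_dominating_cube d D" for D
    using total_dominating_cube.card_bound[OF that] by simp
  with d show "limited_domination_number (d - 1) (hypercube d) = 2 ^ (2 ^ r - r)"
    using limited_domination_number_hypercube[of r d] by simp
next
  assume d: "d = 2 ^ r + 1"
  \<comment> \<open>Here \<open>r \<ge> 1\<close> makes \<open>2 ^ r\<close> even, as the parity
    argument requires.\<close>
  have "odd d" "d \<ge> 2" using d assms by auto
  then have "2 ^ d \<le> 2 ^ r * card D" if "total_dominating_cube d D" for D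
    using total_dominating_cube.card_bound_odd[OF that] d by simp
  moreover have "d - r = 2 ^ r - r + 1"
    using d less_exp[of r] by linarith
  ultimately show "limited_domination_number (d - 1) (hypercube d) = 2 ^ (2 ^ r - r + 1)"
    using limited_domination_number_hypercube[of r d] d by simp
qed

end
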